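(* Let $S$ be a regular semigroup. Then $S$ is completely regular if and only if $R(S)$ is completely regular.
   Context: A semigroup is completely regular if every element lies in a subgroup (equivalently, every $\mathcal{H}$-class is a group). For a semigroup $S$, $E(S)$ denotes its set of idempotents, and $S^1$ denotes $S$ itself if $S$ is a monoid, and otherwise $S$ with an identity $1$ adjoined. Let $R_2=\{\sigma,\tau\}$ be the two-element right-zero semigroup, and let $T*R_2$ be the set $S\times S\times R_2$ with product $(t_1,s_1,\sigma)(t_2,s_2,\alpha_2)=(t_1s_2,\,s_1s_2,\,\alpha_2)$ and $(t_1,s_1,\tau)(t_2,s_2,\alpha_2)=(t_1t_2,\,s_1t_2,\,\alpha_2)$ (a semidirect product of $T=S\times S$ by $R_2$). Let $E=\{(s,t,\alpha)\in E(T*R_2):\ s\in S^1t\}$ and $T(S)=\langle E\rangle$, the subsemigroup generated by $E$; for $S$ regular one has $T(S)=\{(s,t,\alpha)\in T*R_2: s\in S^1t\}$. Let $R(S)=\{(s,t,\alpha)\in T(S):\ s\,\mathcal{L}\,t\text{ in }S\}$, a subsemigroup of $T(S)$. *)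

theory Defs
  imports "HOL-Algebra.Group"
begin

text \<open>A semigroup is given by a carrier set and a binary operation on the ambient type; the
  operation is irrelevant outside the carrier. The empty semigroup is not excluded.\<close>

definition semigroup_on :: "'a set \<Rightarrow> ('a \<Rightarrow> 'a \<Rightarrow> 'a) \<Rightarrow> bool" where
  "semigroup_on S m \<longleftrightarrow>
     (\<forall>x\<in>S. \<forall>y\<in>S. m x y \<in> S) \<and>
     (\<forall>x\<in>S. \<forall>y\<in>S. \<forall>z\<in>S. m (m x y) z = m x (m y z))"

definition regular_semigroup :: "'a set \<Rightarrow> ('a \<Rightarrow> 'a \<Rightarrow> 'a) \<Rightarrow> bool" where
  "regular_semigroup S m \<longleftrightarrow>
     semigroup_on S m \<and> (\<forall>a\<in>S. \<exists>x\<in>S. m (m a x) a = a)"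

definition subgroup_of_semigroup :: "'a set \<Rightarrow> 'a set \<Rightarrow> ('a \<Rightarrow> 'a \<Rightarrow> 'a) \<Rightarrow> bool" where
  "subgroup_of_semigroup G S m \<longleftrightarrow>
     G \<subseteq> S \<and> (\<exists>e. group \<lparr>carrier = G, mult = m, one = e\<rparr>)"

definition completely_regular_semigroup :: "'a set \<Rightarrow> ('a \<Rightarrow> 'a \<Rightarrow> 'a) \<Rightarrow> bool" where
  "completely_regular_semigroup S m \<longleftrightarrow>
     semigroup_on S m \<and> (\<forall>a\<in>S. \<exists>G. subgroup_of_semigroup G S m \<and> a \<in> G)"

definition idempotents :: "'a set \<Rightarrow> ('a \<Rightarrow> 'a \<Rightarrow> 'a) \<Rightarrow> 'a set" where
  "idempotents S m = {e \<in> S. m e e = e}"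

definition has_identity :: "'a set \<Rightarrow> ('a \<Rightarrow> 'a \<Rightarrow> 'a) \<Rightarrow> bool" where
  "has_identity S m \<longleftrightarrow> (\<exists>e\<in>S. \<forall>x\<in>S. m e x = x \<and> m x e = x)"

text \<open>\<open>S\<^sup>1\<close> lives on the option type: \<open>Some\<close> embeds \<open>S\<close>, and \<open>None\<close> is the adjoined
  identity, which belongs to the carrier only if \<open>S\<close> is not already a monoid.\<close>

definition S1_carrier :: "'a set \<Rightarrow> ('a \<Rightarrow> 'a \<Rightarrow> 'a) \<Rightarrow> 'a option set" where
  "S1_carrier S m = (if has_identity S m then Some ` S else insert None (Some ` S))"

fun S1_mult :: "('a \<Rightarrow> 'a \<Rightarrow> 'a) \<Rightarrow> 'a option \<Rightarrow> 'a option \<Rightarrow> 'a option" where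
  "S1_mult m None y = y"
| "S1_mult m (Some x) None = Some x"
| "S1_mult m (Some x) (Some y) = Some (m x y)"

text \<open>The principal left ideal \<open>S\<^sup>1 t\<close>; for \<open>t \<in> S\<close> all products \<open>x t\<close> with \<open>x \<in> S\<^sup>1\<close> are
  again in \<open>S\<close>, so they are pulled back along \<open>Some\<close>.\<close>

definition principal_left_ideal :: "'a set \<Rightarrow> ('a \<Rightarrow> 'a \<Rightarrow> 'a) \<Rightarrow> 'a \<Rightarrow> 'a set" where
  "principal_left_ideal S m t = {s. \<exists>x\<in>S1_carrier S m. Some s = S1_mult m x (Some t)}"

definition green_L :: "'a set \<Rightarrow> ('a \<Rightarrow> 'a \<Rightarrow> 'a) \<Rightarrow> 'a \<Rightarrow> 'a \<Rightarrow> bool" where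
  "green_L S m s t \<longleftrightarrow>
     s \<in> S \<and> t \<in> S \<and> principal_left_ideal S m s = principal_left_ideal S m t"

inductive_set generated_subsemigroup :: "('a \<Rightarrow> 'a \<Rightarrow> 'a) \<Rightarrow> 'a set \<Rightarrow> 'a set"
  for m :: "'a \<Rightarrow> 'a \<Rightarrow> 'a" and E :: "'a set" where
  base: "x \<in> E \<Longrightarrow> x \<in> generated_subsemigroup m E"
| step: "x \<in> generated_subsemigroup m E \<Longrightarrow> y \<in> generated_subsemigroup m E \<Longrightarrow>
    m x y \<in> generated_subsemigroup m E"

datatype R2 = Sigma2 | Tau2

definition TR2_carrier :: "'a set \<Rightarrow> ('a \<times> 'a \<times> R2) set" where
  "TR2_carrier S = S \<times> S \<times> UNIV"

text \<open>In \<open>R2\<close>, a right-zero semigroup, the product of two elements is the second one.\<close>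

fun TR2_mult ::
  "('a \<Rightarrow> 'a \<Rightarrow> 'a) \<Rightarrow> 'a \<times> 'a \<times> R2 \<Rightarrow> 'a \<times> 'a \<times> R2 \<Rightarrow> 'a \<times> 'a \<times> R2" where
  "TR2_mult m (t1, s1, Sigma2) (t2, s2, \<alpha>2) = (m t1 s2, m s1 s2, \<alpha>2)"
| "TR2_mult m (t1, s1, Tau2) (t2, s2, \<alpha>2) = (m t1 t2, m s1 t2, \<alpha>2)"

definition E_set :: "'a set \<Rightarrow> ('a \<Rightarrow> 'a \<Rightarrow> 'a) \<Rightarrow> ('a \<times> 'a \<times> R2) set" where
  "E_set S m = {(s, t, \<alpha>). (s, t, \<alpha>) \<in> idempotents (TR2_carrier S) (TR2_mult m) \<and>
                            s \<in> principal_left_ideal S m t}"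

definition T_semigroup :: "'a set \<Rightarrow> ('a \<Rightarrow> 'a \<Rightarrow> 'a) \<Rightarrow> ('a \<times> 'a \<times> R2) set" where
  "T_semigroup S m = generated_subsemigroup (TR2_mult m) (E_set S m)"

definition R_semigroup :: "'a set \<Rightarrow> ('a \<Rightarrow> 'a \<Rightarrow> 'a) \<Rightarrow> ('a \<times> 'a \<times> R2) set" where
  "R_semigroup S m = {(s, t, \<alpha>). (s, t, \<alpha>) \<in> T_semigroup S m \<and> green_L S m s t}"

end

theory Submission
  imports Defs
begin

text \<open>
  Complete regularity is an equational existence property: \<open>a\<close> lies in a subgroup iff some \<open>x\<close>
  satisfies \<open>a x a = a\<close> and \<open>a x = x a\<close>. The proof transfers such commuting inverses between the
  two semigroups.

  Every \<open>\<L>\<close>-related pair is a coordinate pair of an element of \<open>T(S)\<close> with either tag, so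
  \<open>R(S)\<close> consists of exactly the triples \<open>(p, q, \<alpha>)\<close> with \<open>p \<L> q\<close>
  (\<open>R_semigroup_eq_green_L\<close>). A triple multiplies from the left through the
  coordinate selected by its tag: \<open>(p, q, \<sigma>)\<close> multiplies both coordinates by the \<^emph>\<open>second\<close>
  coordinate of the right factor and \<open>(p, q, \<tau>)\<close> by the \<^emph>\<open>first\<close> one.

  If \<open>S\<close> is completely regular and \<open>q\<close> has the group inverse \<open>y\<close>, then \<open>(p y y, y, \<sigma>)\<close> is a
  commuting inverse of \<open>(p, q, \<sigma>)\<close>: on the second coordinate it is the group inverse, and on the
  first coordinate it works because \<open>p \<in> S q\<close> absorbs the idempotent \<open>y q\<close> on the right. It is
  in \<open>R(S)\<close> because \<open>\<L>\<close> is a right congruence, so that \<open>p y y \<L> q y y = y\<close>.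
  The case \<open>\<tau>\<close> is the same with the coordinates exchanged.
  Conversely, the second coordinate of a commuting inverse of \<open>(s, s, \<sigma>)\<close> is a commuting
  inverse of \<open>s\<close>.
\<close>

section \<open>Complete regularity and commuting inverses\<close>

lemma commuting_reflexive_inverse:
  fixes m :: "'a \<Rightarrow> 'a \<Rightarrow> 'a" (infixl "\<cdot>" 70)
  assumes "semigroup_on S m" "a \<in> S" "x \<in> S" "a \<cdot> x \<cdot> a = a" "a \<cdot> x = x \<cdot> a"
  obtains y where "y \<in> S" "a \<cdot> y \<cdot> a = a" "y \<cdot> a \<cdot> y = y" "a \<cdot> y = y \<cdot> a"
proof
  have cl: "\<And>u v. u \<in> S \<Longrightarrow> v \<in> S \<Longrightarrow> u \<cdot> v \<in> S"
    and as: "\<And>u v w. u \<in> S \<Longrightarrow> v \<in> S \<Longrightarrow> w \<in> S \<Longrightarrow> u \<cdot> v \<cdot> w = u \<cdot> (v \<cdot> w)"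
    using assms(1) by (auto simp: semigroup_on_def)
  let ?y = "x \<cdot> a \<cdot> x"
  show "?y \<in> S" using assms cl by auto
  have axa: "a \<cdot> (x \<cdot> a) = a" using assms as by metis
  have axa': "a \<cdot> (x \<cdot> (a \<cdot> z)) = a \<cdot> z" if "z \<in> S" for z
    using axa as cl assms(2,3) that by metis
  show "a \<cdot> ?y \<cdot> a = a" "?y \<cdot> a \<cdot> ?y = ?y"
    using assms(2,3) by (simp_all add: as cl axa axa')
  have "a \<cdot> ?y = a \<cdot> x" "?y \<cdot> a = x \<cdot> a"
    using assms(2,3) by (simp_all add: as cl axa axa')
  then show "a \<cdot> ?y = ?y \<cdot> a" using assms(5) by simp
qed

text \<open>
  With mutually inverse commuting \<open>a\<close> and \<open>y\<close>, the product \<open>e = a y\<close> is an idempotent and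
  \<open>a\<close>, \<open>y\<close> are mutually inverse units of the local monoid \<open>e S e\<close>, whose group of units is the
  required subgroup (it is the maximal subgroup at \<open>e\<close>).
\<close>

lemma subgroup_containing_if_commuting_inverse:
  fixes m :: "'a \<Rightarrow> 'a \<Rightarrow> 'a" (infixl "\<cdot>" 70)
  assumes S: "semigroup_on S m" and a: "a \<in> S"
    and x: "x \<in> S" "a \<cdot> x \<cdot> a = a" "a \<cdot> x = x \<cdot> a"
  shows "\<exists>G. subgroup_of_semigroup G S m \<and> a \<in> G"
proof -
  have cl: "\<And>u v. u \<in> S \<Longrightarrow> v \<in> S \<Longrightarrow> u \<cdot> v \<in> S"
    and as: "\<And>u v w. u \<in> S \<Longrightarrow> v \<in> S \<Longrightarrow> w \<in> S \<Longrightarrow> u \<cdot> v \<cdot> w = u \<cdot> (v \<cdot> w)"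
    using S by (auto simp: semigroup_on_def)
  obtain y where y: "y \<in> S" "a \<cdot> y \<cdot> a = a" "y \<cdot> a \<cdot> y = y" "a \<cdot> y = y \<cdot> a"
    using commuting_reflexive_inverse[OF S a x] .
  define e where "e = a \<cdot> y"
  have e: "e \<in> S" "e \<cdot> e = e" "e \<cdot> a = a" "a \<cdot> e = a" "e \<cdot> y = y" "y \<cdot> e = y"
    using a y as cl unfolding e_def by metis+
  define unit where "unit b c \<longleftrightarrow> b \<in> S \<and> c \<in> S \<and> e \<cdot> b = b \<and> b \<cdot> e = b \<and>
    e \<cdot> c = c \<and> c \<cdot> e = c \<and> b \<cdot> c = e \<and> c \<cdot> b = e" for b c
  define G where "G = {b. \<exists>c. unit b c}"
  have unit_mult: "unit (b \<cdot> b') (c' \<cdot> c)" if "unit b c" "unit b' c'" for b c b' c'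
  proof -
    have S: "b \<in> S" "c \<in> S" "b' \<in> S" "c' \<in> S"
      using that by (auto simp: unit_def)
    have "b \<cdot> b' \<cdot> (c' \<cdot> c) = b \<cdot> (b' \<cdot> c') \<cdot> c" "c' \<cdot> c \<cdot> (b \<cdot> b') = c' \<cdot> (c \<cdot> b) \<cdot> b'"
      using S by (metis as cl)+
    then have "b \<cdot> b' \<cdot> (c' \<cdot> c) = e" "c' \<cdot> c \<cdot> (b \<cdot> b') = e"
      using that by (simp_all add: unit_def)
    moreover have "e \<cdot> (b \<cdot> b') = b \<cdot> b'" "b \<cdot> b' \<cdot> e = b \<cdot> b'"
        "e \<cdot> (c' \<cdot> c) = c' \<cdot> c" "c' \<cdot> c \<cdot> e = c' \<cdot> c"
      using that S e(1) unfolding unit_def by (metis as)+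
    ultimately show ?thesis
      using S cl by (simp add: unit_def)
  qed
  have "group \<lparr>carrier = G, mult = m, one = e\<rparr>"
  proof (rule groupI, simp_all)
    show "b \<cdot> b' \<in> G" if bb': "b \<in> G" "b' \<in> G" for b b'
    proof -
      obtain c c' where "unit b c" "unit b' c'"
        using bb' by (auto simp: G_def)
      from unit_mult[OF this] show ?thesis by (auto simp: G_def)
    qed
    show "e \<in> G" using e by (auto simp: G_def unit_def)
    show "b \<cdot> c \<cdot> d = b \<cdot> (c \<cdot> d)" if "b \<in> G" "c \<in> G" "d \<in> G" for b c d
      using that as by (auto simp: G_def unit_def)
    show "e \<cdot> b = b" if "b \<in> G" for b
      using that by (auto simp: G_def unit_def)
    show "\<exists>c\<in>G. c \<cdot> b = e" if "b \<in> G" for b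
      using that by (auto simp: G_def unit_def)
  qed
  moreover have "unit a y" using a y e by (auto simp: unit_def e_def)
  ultimately have "subgroup_of_semigroup G S m" "a \<in> G"
    by (auto simp: subgroup_of_semigroup_def G_def unit_def)
  then show ?thesis by blast
qed

lemma completely_regular_iff_commuting_inverses:
  fixes m :: "'a \<Rightarrow> 'a \<Rightarrow> 'a" (infixl "\<cdot>" 70)
  shows "completely_regular_semigroup S m \<longleftrightarrow>
    semigroup_on S m \<and> (\<forall>a\<in>S. \<exists>x\<in>S. a \<cdot> x \<cdot> a = a \<and> a \<cdot> x = x \<cdot> a)"
proof -
  have "\<exists>x\<in>S. a \<cdot> x \<cdot> a = a \<and> a \<cdot> x = x \<cdot> a"
    if G: "subgroup_of_semigroup G S m" "a \<in> G" for a G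
  proof -
    obtain e where "group \<lparr>carrier = G, mult = m, one = e\<rparr>" and GS: "G \<subseteq> S"
      using G by (auto simp: subgroup_of_semigroup_def)
    then interpret group "\<lparr>carrier = G, mult = m, one = e\<rparr>" by simp
    obtain x where "x \<in> G" "a \<cdot> x = e" "x \<cdot> a = e"
      using G(2) r_inv l_inv inv_closed by fastforce
    moreover have "e \<cdot> a = a" using G(2) l_one by simp
    ultimately show ?thesis using GS by auto
  qed
  then show ?thesis
    using subgroup_containing_if_commuting_inverse
    unfolding completely_regular_semigroup_def by metis
qed

section \<open>The relation \<open>\<L>\<close> in a regular semigroup\<close>

text \<open>In a regular semigroup \<open>t = (t t') t\<close>, so the adjoined identity contributes nothing new.\<close>

lemma principal_left_ideal_regular:
  fixes m :: "'a \<Rightarrow> 'a \<Rightarrow> 'a" (infixl "\<cdot>" 70)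
  assumes "regular_semigroup S m" "t \<in> S"
  shows "principal_left_ideal S m t = (\<lambda>x. x \<cdot> t) ` S"
proof -
  obtain x where "x \<in> S" "t \<cdot> x \<cdot> t = t" "t \<cdot> x \<in> S"
    using assms unfolding regular_semigroup_def semigroup_on_def by blast
  then have "t \<in> (\<lambda>x. x \<cdot> t) ` S" by force
  then show ?thesis
    by (auto simp: principal_left_ideal_def S1_carrier_def)
qed

lemma green_L_regular_iff:
  fixes m :: "'a \<Rightarrow> 'a \<Rightarrow> 'a" (infixl "\<cdot>" 70)
  assumes "regular_semigroup S m"
  shows "green_L S m p q \<longleftrightarrow>
    p \<in> S \<and> q \<in> S \<and> (\<exists>x\<in>S. p = x \<cdot> q) \<and> (\<exists>y\<in>S. q = y \<cdot> p)"
proof -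
  have cl: "\<And>u v. u \<in> S \<Longrightarrow> v \<in> S \<Longrightarrow> u \<cdot> v \<in> S"
    and as: "\<And>u v w. u \<in> S \<Longrightarrow> v \<in> S \<Longrightarrow> w \<in> S \<Longrightarrow> u \<cdot> v \<cdot> w = u \<cdot> (v \<cdot> w)"
    using assms by (auto simp: regular_semigroup_def semigroup_on_def)
  have self: "t \<in> (\<lambda>x. x \<cdot> t) ` S" if t: "t \<in> S" for t
  proof -
    obtain x where "x \<in> S" "t \<cdot> x \<cdot> t = t"
      using assms t by (auto simp: regular_semigroup_def)
    with cl[of t x] t show ?thesis by force
  qed
  have sub: "(\<lambda>x. x \<cdot> (y \<cdot> t)) ` S \<subseteq> (\<lambda>x. x \<cdot> t) ` S" if "y \<in> S" "t \<in> S" for y t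
    using that cl by (auto simp flip: as)
  have "(\<lambda>x. x \<cdot> p) ` S = (\<lambda>x. x \<cdot> q) ` S \<longleftrightarrow> p \<in> (\<lambda>x. x \<cdot> q) ` S \<and> q \<in> (\<lambda>x. x \<cdot> p) ` S"
    if "p \<in> S" "q \<in> S"
  proof
    assume "(\<lambda>x. x \<cdot> p) ` S = (\<lambda>x. x \<cdot> q) ` S"
    then show "p \<in> (\<lambda>x. x \<cdot> q) ` S \<and> q \<in> (\<lambda>x. x \<cdot> p) ` S"
      using self that by blast
  next
    assume "p \<in> (\<lambda>x. x \<cdot> q) ` S \<and> q \<in> (\<lambda>x. x \<cdot> p) ` S"
    then obtain x y where xy: "x \<in> S" "p = x \<cdot> q" "y \<in> S" "q = y \<cdot> p" by blast
    show "(\<lambda>x. x \<cdot> p) ` S = (\<lambda>x. x \<cdot> q) ` S"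
      using sub[OF xy(1) that(2), folded xy(2)] sub[OF xy(3) that(1), folded xy(4)]
      by (rule subset_antisym)
  qed
  then show ?thesis
    unfolding green_L_def image_iff using principal_left_ideal_regular[OF assms] by metis
qed

lemma green_L_refl:
  "s \<in> S \<Longrightarrow> green_L S m s s"
  by (simp add: green_L_def)

lemma green_L_sym:
  "green_L S m p q \<Longrightarrow> green_L S m q p"
  by (simp add: green_L_def)

lemma green_L_right_congruence:
  fixes m :: "'a \<Rightarrow> 'a \<Rightarrow> 'a" (infixl "\<cdot>" 70)
  assumes "regular_semigroup S m" "green_L S m p q" "z \<in> S"
  shows "green_L S m (p \<cdot> z) (q \<cdot> z)"
proof -
  have "semigroup_on S m" using assms by (simp add: regular_semigroup_def)
  then show ?thesis
    using assms(2,3) unfolding green_L_regular_iff[OF assms(1)] semigroup_on_def by metis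
qed

section \<open>The elements of \<open>R(S)\<close>\<close>

text \<open>
  Let \<open>p = x q\<close> and let \<open>q'\<close> be an inverse of \<open>q\<close>, so that \<open>e = q q'\<close> and \<open>f = q' q\<close> are
  idempotents. The triples \<open>(f, q, \<tau>)\<close>, \<open>(f, f, \<sigma>)\<close> and \<open>(x e, e, \<sigma>)\<close> belong to the generating
  set \<open>E\<close>. The first one already has second coordinate \<open>q\<close>; right multiplication by the second
  one changes its tag to \<open>\<sigma>\<close>; and left multiplication by the third one turns the first
  coordinate into \<open>x e q = p\<close>.
\<close>

lemma T_semigroup_contains:
  fixes m :: "'a \<Rightarrow> 'a \<Rightarrow> 'a" (infixl "\<cdot>" 70)
  assumes reg: "regular_semigroup S m" and q: "q \<in> S" and x: "x \<in> S"
  shows "(x \<cdot> q, q, \<alpha>) \<in> T_semigroup S m"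
proof -
  have cl: "\<And>u v. u \<in> S \<Longrightarrow> v \<in> S \<Longrightarrow> u \<cdot> v \<in> S"
    and as: "\<And>u v w. u \<in> S \<Longrightarrow> v \<in> S \<Longrightarrow> w \<in> S \<Longrightarrow> u \<cdot> v \<cdot> w = u \<cdot> (v \<cdot> w)"
    using reg by (auto simp: regular_semigroup_def semigroup_on_def)
  obtain q' where q': "q' \<in> S" "q \<cdot> q' \<cdot> q = q"
    using reg q by (auto simp: regular_semigroup_def)
  define e where "e = q \<cdot> q'"
  define f where "f = q' \<cdot> q"
  have S: "e \<in> S" "f \<in> S" "x \<cdot> e \<in> S" using q q' x cl by (auto simp: e_def f_def)
  have eq: "e \<cdot> q = q" "e \<cdot> e = e" "q \<cdot> f = q" "f \<cdot> f = f"
    using q q' as cl unfolding e_def f_def by metis+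
  have "f \<in> (\<lambda>z. z \<cdot> q) ` S" "f \<in> (\<lambda>z. z \<cdot> f) ` S" "x \<cdot> e \<in> (\<lambda>z. z \<cdot> e) ` S"
    using q'(1) x S(2) eq(4) by (auto simp: f_def intro: rev_image_eqI)
  then have "(f, q, Tau2) \<in> E_set S m" "(f, f, Sigma2) \<in> E_set S m" "(x \<cdot> e, e, Sigma2) \<in> E_set S m"
    using q x S eq
    by (simp_all add: E_set_def idempotents_def TR2_carrier_def
          principal_left_ideal_regular[OF reg] as)
  then have gen: "(f, q, Tau2) \<in> T_semigroup S m" "(f, f, Sigma2) \<in> T_semigroup S m"
      "(x \<cdot> e, e, Sigma2) \<in> T_semigroup S m"
    by (simp_all add: T_semigroup_def generated_subsemigroup.base)
  have mult: "TR2_mult m a b \<in> T_semigroup S m"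
    if "a \<in> T_semigroup S m" "b \<in> T_semigroup S m" for a b
    using that by (auto simp: T_semigroup_def intro: generated_subsemigroup.step)
  have "(f, q, \<alpha>) \<in> T_semigroup S m"
    using gen(1) mult[OF gen(1,2)] eq by (cases \<alpha>) auto
  from mult[OF gen(3) this] show ?thesis
    using x q S eq by (simp add: as)
qed

lemma R_semigroup_eq_green_L:
  assumes "regular_semigroup S m"
  shows "R_semigroup S m = {(p, q, \<alpha>). green_L S m p q}"
proof -
  have "(p, q, \<alpha>) \<in> T_semigroup S m" if "green_L S m p q" for p q \<alpha>
    using that T_semigroup_contains[OF assms] unfolding green_L_regular_iff[OF assms] by metis
  then show ?thesis
    by (auto simp: R_semigroup_def)
qed

lemma semigroup_on_R_semigroup:
  fixes m :: "'a \<Rightarrow> 'a \<Rightarrow> 'a" (infixl "\<cdot>" 70)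
  assumes reg: "regular_semigroup S m"
  shows "semigroup_on (R_semigroup S m) (TR2_mult m)"
proof -
  have as: "\<And>u v w. u \<in> S \<Longrightarrow> v \<in> S \<Longrightarrow> w \<in> S \<Longrightarrow> u \<cdot> v \<cdot> w = u \<cdot> (v \<cdot> w)"
    using reg by (auto simp: regular_semigroup_def semigroup_on_def)
  have L: "green_L S m p q \<Longrightarrow> p \<in> S \<and> q \<in> S" for p q
    by (simp add: green_L_def)
  have "TR2_mult m (p, q, \<alpha>) (p', q', \<beta>) \<in> R_semigroup S m"
    if "green_L S m p q" "green_L S m p' q'" for p q \<alpha> p' q' \<beta>
    using that L green_L_right_congruence[OF reg that(1)]
    by (cases \<alpha>) (auto simp: R_semigroup_eq_green_L[OF reg])
  moreover have "TR2_mult m (TR2_mult m (p, q, \<alpha>) (p', q', \<beta>)) (p'', q'', \<gamma>) =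
      TR2_mult m (p, q, \<alpha>) (TR2_mult m (p', q', \<beta>) (p'', q'', \<gamma>))"
    if "green_L S m p q" "green_L S m p' q'" "green_L S m p'' q''"
    for p q \<alpha> p' q' \<beta> p'' q'' \<gamma>
    using that[THEN L] as by (cases \<alpha>; cases \<beta>) auto
  ultimately show ?thesis
    by (auto simp: semigroup_on_def R_semigroup_eq_green_L[OF reg])
qed

section \<open>Transfer of commuting inverses\<close>

text \<open>
  The coordinate \<open>q\<close> is the one through which the triple multiplies; \<open>p\<close> is only carried along.
  Here \<open>y\<close> is the group inverse of \<open>q\<close>, and \<open>p y q = p\<close> holds because \<open>p \<in> S q\<close>.
  The equations say that \<open>(p y y, y)\<close>, in this order of roles, is a commuting inverse of
  \<open>(p, q)\<close>, which covers the tag \<open>\<sigma>\<close> directly and the tag \<open>\<tau>\<close> after exchanging coordinates.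
\<close>

lemma green_L_commuting_inverse:
  fixes m :: "'a \<Rightarrow> 'a \<Rightarrow> 'a" (infixl "\<cdot>" 70)
  assumes reg: "regular_semigroup S m" and cr: "completely_regular_semigroup S m"
    and L: "green_L S m p q"
  obtains y where "green_L S m (p \<cdot> y \<cdot> y) y" "q \<cdot> y \<cdot> q = q" "q \<cdot> y = y \<cdot> q"
    "p \<cdot> y \<cdot> q = p" "p \<cdot> y \<cdot> y \<cdot> q = p \<cdot> y"
proof -
  have S: "semigroup_on S m" using reg by (simp add: regular_semigroup_def)
  then have cl: "\<And>u v. u \<in> S \<Longrightarrow> v \<in> S \<Longrightarrow> u \<cdot> v \<in> S"
    and as: "\<And>u v w. u \<in> S \<Longrightarrow> v \<in> S \<Longrightarrow> w \<in> S \<Longrightarrow> u \<cdot> v \<cdot> w = u \<cdot> (v \<cdot> w)"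
    by (auto simp: semigroup_on_def)
  obtain x where pq: "p \<in> S" "q \<in> S" "x \<in> S" "p = x \<cdot> q"
    using L unfolding green_L_regular_iff[OF reg] by blast
  obtain z where z: "z \<in> S" "q \<cdot> z \<cdot> q = q" "q \<cdot> z = z \<cdot> q"
    using cr pq(2) by (auto simp: completely_regular_iff_commuting_inverses)
  obtain y where y: "y \<in> S" "q \<cdot> y \<cdot> q = q" "y \<cdot> q \<cdot> y = y" "q \<cdot> y = y \<cdot> q"
    using commuting_reflexive_inverse[OF S pq(2) z] .
  have "q \<cdot> y \<cdot> y = y" using y by simp
  then have "green_L S m (p \<cdot> y \<cdot> y) y"
    using green_L_right_congruence[OF reg green_L_right_congruence[OF reg L y(1)] y(1)] by simp
  moreover have "p \<cdot> y \<cdot> q = x \<cdot> (q \<cdot> y \<cdot> q)" using pq y by (simp add: as cl)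
  then have "p \<cdot> y \<cdot> q = p" using y pq by simp
  moreover have "p \<cdot> y \<cdot> y \<cdot> q = p \<cdot> y"
    using pq(1,2) y as cl by metis
  ultimately show ?thesis using y that by blast
qed

lemma completely_regular_R_semigroup:
  fixes m :: "'a \<Rightarrow> 'a \<Rightarrow> 'a" (infixl "\<cdot>" 70)
  assumes reg: "regular_semigroup S m" and cr: "completely_regular_semigroup S m"
  shows "completely_regular_semigroup (R_semigroup S m) (TR2_mult m)"
proof -
  have "\<exists>b\<in>R_semigroup S m.
      TR2_mult m (TR2_mult m (p, q, \<alpha>) b) (p, q, \<alpha>) = (p, q, \<alpha>) \<and>
      TR2_mult m (p, q, \<alpha>) b = TR2_mult m b (p, q, \<alpha>)"
    if L: "green_L S m p q" for p q \<alpha>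
  proof (cases \<alpha>)
    case Sigma2
    obtain y where y: "green_L S m (p \<cdot> y \<cdot> y) y" "q \<cdot> y \<cdot> q = q" "q \<cdot> y = y \<cdot> q"
        "p \<cdot> y \<cdot> q = p" "p \<cdot> y \<cdot> y \<cdot> q = p \<cdot> y"
      using green_L_commuting_inverse[OF reg cr L] .
    show ?thesis
      using y Sigma2
      by (intro bexI[of _ "(p \<cdot> y \<cdot> y, y, Sigma2)"]) (auto simp: R_semigroup_eq_green_L[OF reg])
  next
    case Tau2
    obtain y where y: "green_L S m (q \<cdot> y \<cdot> y) y" "p \<cdot> y \<cdot> p = p" "p \<cdot> y = y \<cdot> p"
        "q \<cdot> y \<cdot> p = q" "q \<cdot> y \<cdot> y \<cdot> p = q \<cdot> y"
      using green_L_commuting_inverse[OF reg cr green_L_sym[OF L]] .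
    show ?thesis
      using y Tau2 green_L_sym[OF y(1)]
      by (intro bexI[of _ "(y, q \<cdot> y \<cdot> y, Tau2)"]) (auto simp: R_semigroup_eq_green_L[OF reg])
  qed
  then show ?thesis
    using semigroup_on_R_semigroup[OF reg]
    by (auto simp: completely_regular_iff_commuting_inverses R_semigroup_eq_green_L[OF reg])
qed

text \<open>
  A commuting inverse of \<open>(s, s, \<sigma>)\<close> has tag \<open>\<sigma>\<close>, because a product in \<open>T(S)\<close> has the tag of its
  right factor. Hence all products involved are computed through second coordinates, where they
  are products in \<open>S\<close>.
\<close>

lemma completely_regular_if_R_semigroup:
  fixes m :: "'a \<Rightarrow> 'a \<Rightarrow> 'a" (infixl "\<cdot>" 70)
  assumes reg: "regular_semigroup S m"
    and crR: "completely_regular_semigroup (R_semigroup S m) (TR2_mult m)"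
  shows "completely_regular_semigroup S m"
proof -
  have "\<exists>q\<in>S. s \<cdot> q \<cdot> s = s \<and> s \<cdot> q = q \<cdot> s" if s: "s \<in> S" for s
  proof -
    have "(s, s, Sigma2) \<in> R_semigroup S m"
      using green_L_refl[OF s] by (simp add: R_semigroup_eq_green_L[OF reg])
    then obtain p q \<beta> where b: "(p, q, \<beta>) \<in> R_semigroup S m"
      "TR2_mult m (TR2_mult m (s, s, Sigma2) (p, q, \<beta>)) (s, s, Sigma2) = (s, s, Sigma2)"
      "TR2_mult m (s, s, Sigma2) (p, q, \<beta>) = TR2_mult m (p, q, \<beta>) (s, s, Sigma2)"
      using crR unfolding completely_regular_iff_commuting_inverses by (metis prod_cases3)
    then have "\<beta> = Sigma2" by (cases \<beta>) auto
    moreover have "q \<in> S"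
      using b(1) by (simp add: R_semigroup_eq_green_L[OF reg] green_L_def)
    moreover have "s \<cdot> q \<cdot> s = s"
      using b(2) \<open>\<beta> = Sigma2\<close> by simp
    moreover have "s \<cdot> q = q \<cdot> s"
      using b(3) unfolding \<open>\<beta> = Sigma2\<close> TR2_mult.simps prod.inject by blast
    ultimately show ?thesis by blast
  qed
  then show ?thesis
    using reg by (simp add: completely_regular_iff_commuting_inverses regular_semigroup_def)
qed

theorem proposition5p6:
  fixes S :: "'a set" and m :: "'a \<Rightarrow> 'a \<Rightarrow> 'a"
  assumes "regular_semigroup S m"
  shows "completely_regular_semigroup S m \<longleftrightarrow>
    completely_regular_semigroup (R_semigroup S m) (TR2_mult m)"
  using completely_regular_R_semigroup[OF assms] completely_regular_if_R_semigroup[OF assms]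
  by blast

end
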